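(* Let $(X,d)$ be a metric space, $Y$ a topological space and $\pi:X\to Y$ a quotient map. Suppose there is a measure $\mu$ on $Y$ such that for every $r_0>0$ and every $x,x'\in X$ with $\pi(x)=\pi(x')$ there is $C>0$ such that $$\mu(\pi(B(x,r)))\le C\,\mu(\pi(B(x',r)))\qquad\text{for every } r>r_0.$$ Let $L\ge 1$, $M\ge 0$, $Q\in(0,\infty)$, and suppose that $\phi:Y\to X$ is an intrinsically $(L,M)$-quasi-isometric section of $\pi$ such that $\phi(Y)$ is, for large scale, $Q$-Ahlfors-David regular with respect to the measure $\phi_*\mu$. Then, for every intrinsically $(L,M)$-quasi-isometric section $\psi:Y\to X$ of $\pi$, the set $\psi(Y)$ satisfies the following: for every $y\in Y$ there exist $r_0>0$ and constants $c_3,c_4>0$ such that $$c_3\,(r-M)^Q\le \psi_*\mu\big(B(\psi(y),r)\cap\psi(Y)\big)\le c_4\,(r+M)^Q\qquad\text{for every } r>r_0.$$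
   Context: A quotient map $\pi:X\to Y$ means a continuous, open and surjective map. $B(x,r)$ is the ball of center $x$ and radius $r$ in $X$, i.e. $\{x'\in X: d(x,x')<r\}$. For $A\subset X$ and $x\in X$, $d(x,A):=\inf\{d(x,a):a\in A\}$. A map $\phi:Y\to X$ is a section of $\pi$ if $\pi\circ\phi=\mathrm{id}_Y$. It is an intrinsically $(L,M)$-quasi-isometric section of $\pi$ (with $L\ge1$, $M\ge0$) if in addition $$d(\phi(y_1),\phi(y_2))\le L\,d(\phi(y_1),\pi^{-1}(y_2))+M\quad\text{for all } y_1,y_2\in Y.$$ $\phi_*\mu$ denotes the push-forward measure, $\phi_*\mu(A)=\mu(\phi^{-1}(A))$. $\phi(Y)$ is, for large scale, $Q$-Ahlfors-David regular with respect to $\phi_*\mu$ if for each point $x\in\phi(Y)$ there exist $r_0>0$ and $C>0$ such that $$C^{-1}r^Q\le\phi_*\mu\big(B(x,r)\cap\phi(Y)\big)\le C r^Q\quad\text{for all } r>r_0.$$ *)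

theory Defs
  imports "HOL-Analysis.Analysis"
begin

(* Stronger than quotient_map of HOL-Analysis.Abstract_Topology: openness is required. *)
definition open_quotient_map :: "('x::topological_space \<Rightarrow> 'y::topological_space) \<Rightarrow> bool" where
  "open_quotient_map \<pi> \<longleftrightarrow>
     continuous_on UNIV \<pi> \<and> open_map euclidean euclidean \<pi> \<and> surj \<pi>"

definition is_section :: "('x \<Rightarrow> 'y) \<Rightarrow> ('y \<Rightarrow> 'x) \<Rightarrow> bool" where
  "is_section \<pi> \<phi> \<longleftrightarrow> \<pi> \<circ> \<phi> = id"

(* infdist takes the value 0 on the empty set, but here the fibres are nonempty
   because \<pi> has a section. *)
definition quasi_isometric_section ::
    "real \<Rightarrow> real \<Rightarrow> ('x::metric_space \<Rightarrow> 'y) \<Rightarrow> ('y \<Rightarrow> 'x) \<Rightarrow> bool" where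
  "quasi_isometric_section L M \<pi> \<phi> \<longleftrightarrow>
     is_section \<pi> \<phi> \<and>
     (\<forall>y1 y2. dist (\<phi> y1) (\<phi> y2) \<le> L * infdist (\<phi> y1) (\<pi> -` {y2}) + M)"

(* Sections need not be continuous or measurable, so the preimage of a set need not lie in
   sets \<mu>.  Since emeasure is 0 outside sets \<mu>, a measure is evaluated on arbitrary subsets
   through its outer measure, which coincides with emeasure on sets \<mu> (outer_measure_of_eq). *)
definition push_forward :: "('y \<Rightarrow> 'x) \<Rightarrow> 'y measure \<Rightarrow> 'x set \<Rightarrow> ennreal" where
  "push_forward \<phi> \<mu> A = outer_measure_of \<mu> (\<phi> -` A)"

lemma push_forward_eq_emeasure:
  "\<phi> -` A \<in> sets \<mu> \<Longrightarrow> push_forward \<phi> \<mu> A = emeasure \<mu> (\<phi> -` A)"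
  by (simp add: push_forward_def)

lemma push_forward_eq_distr:
  assumes "space \<mu> = UNIV" "\<phi> \<in> measurable \<mu> N" "A \<in> sets N"
  shows "push_forward \<phi> \<mu> A = emeasure (distr \<mu> N \<phi>) A"
  using measurable_sets[OF assms(2,3)] assms by (simp add: push_forward_def emeasure_distr)

definition large_scale_AD_regular ::
    "real \<Rightarrow> ('x::metric_space set \<Rightarrow> ennreal) \<Rightarrow> 'x set \<Rightarrow> bool" where
  "large_scale_AD_regular Q \<nu> S \<longleftrightarrow>
     (\<forall>x\<in>S. \<exists>r0>0. \<exists>C>0. \<forall>r>r0.
        ennreal (inverse C * r powr Q) \<le> \<nu> (ball x r \<inter> S) \<and>
        \<nu> (ball x r \<inter> S) \<le> ennreal (C * r powr Q))"

end

theory Submission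
  imports Defs
begin

text \<open>
  For a quasi-isometric section \<open>\<psi>\<close> of \<open>\<pi>\<close>, the set \<open>\<psi> -` ball (\<psi> y) r\<close>, whose measure is at stake,
  is squeezed between projections of balls: it is contained in \<open>\<pi> ` ball (\<psi> y) r\<close>, since \<open>\<psi>\<close> is
  a section, and it contains \<open>\<pi> ` ball (\<psi> y) s\<close> when \<open>r = L * s + M\<close>, since \<open>\<psi>\<close> is quasi-isometric.
  The hypothesis on \<open>\<mu>\<close> compares the projections of balls centred at two points of the same fibre,
  such as \<open>\<psi> y\<close> and \<open>\<phi> y\<close>. Hence any two quasi-isometric sections satisfy
  \<open>\<mu> (\<psi> -` ball (\<psi> y) r) \<le> C * \<mu> (\<theta> -` ball (\<theta> y) (L * r + M))\<close> for large \<open>r\<close>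
  (lemma \<open>section_preimage_ball_comparison\<close>). Taking \<open>\<theta> = \<phi>\<close> gives the upper bound for \<open>\<psi>\<close>;
  exchanging the two sections and taking the radius \<open>(r - M) / L\<close> gives the lower bound.
\<close>

lemma section_proj [simp]:
  "quasi_isometric_section L M \<pi> \<psi> \<Longrightarrow> \<pi> (\<psi> y) = y"
  by (auto simp: quasi_isometric_section_def is_section_def fun_eq_iff)

lemma push_forward_Int_range [simp]:
  "push_forward \<psi> \<mu> (A \<inter> range \<psi>) = push_forward \<psi> \<mu> A"
  unfolding push_forward_def by (rule arg_cong[where f = "outer_measure_of \<mu>"]) auto

lemma section_preimage_ball_subset:
  assumes "quasi_isometric_section L M \<pi> \<psi>"
  shows "\<psi> -` ball (\<psi> y) r \<subseteq> \<pi> ` ball (\<psi> y) r"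
proof
  fix z assume "z \<in> \<psi> -` ball (\<psi> y) r"
  then have "\<psi> z \<in> ball (\<psi> y) r" by simp
  then have "\<pi> (\<psi> z) \<in> \<pi> ` ball (\<psi> y) r" by (rule imageI)
  then show "z \<in> \<pi> ` ball (\<psi> y) r" using assms by simp
qed

lemma proj_ball_subset_section_preimage:
  assumes "quasi_isometric_section L M \<pi> \<psi>" "L > 0"
  shows "\<pi> ` ball (\<psi> y) r \<subseteq> \<psi> -` ball (\<psi> y) (L * r + M)"
proof
  fix z assume "z \<in> \<pi> ` ball (\<psi> y) r"
  then obtain x where x: "dist (\<psi> y) x < r" "z = \<pi> x" by auto
  have "infdist (\<psi> y) (\<pi> -` {z}) \<le> dist (\<psi> y) x"
    using x by (intro infdist_le) auto
  also have "\<dots> < r" by (rule x)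
  finally have "L * infdist (\<psi> y) (\<pi> -` {z}) + M < L * r + M"
    using assms(2) by simp
  moreover have "dist (\<psi> y) (\<psi> z) \<le> L * infdist (\<psi> y) (\<pi> -` {z}) + M"
    using assms(1) by (simp add: quasi_isometric_section_def)
  ultimately show "z \<in> \<psi> -` ball (\<psi> y) (L * r + M)" by simp
qed

lemma section_preimage_ball_comparison:
  assumes "quasi_isometric_section L M \<pi> \<psi>" "quasi_isometric_section L M \<pi> \<theta>" "L > 0"
    and "outer_measure_of \<mu> (\<pi> ` ball (\<psi> y) r)
           \<le> ennreal C * outer_measure_of \<mu> (\<pi> ` ball (\<theta> y) r)"
  shows "push_forward \<psi> \<mu> (ball (\<psi> y) r)
           \<le> ennreal C * push_forward \<theta> \<mu> (ball (\<theta> y) (L * r + M))"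
proof -
  have "push_forward \<psi> \<mu> (ball (\<psi> y) r) \<le> outer_measure_of \<mu> (\<pi> ` ball (\<psi> y) r)"
    unfolding push_forward_def
    by (intro outer_measure_of_mono section_preimage_ball_subset[OF assms(1)])
  also have "\<dots> \<le> ennreal C * outer_measure_of \<mu> (\<pi> ` ball (\<theta> y) r)"
    by (rule assms)
  also have "\<dots> \<le> ennreal C * push_forward \<theta> \<mu> (ball (\<theta> y) (L * r + M))"
    unfolding push_forward_def
    by (intro mult_left_mono outer_measure_of_mono
          proj_ball_subset_section_preimage[OF assms(2,3)]) simp
  finally show ?thesis .
qed

lemma ennreal_inverse_mult_le:
  assumes "C > 0" "a \<ge> 0" "ennreal a \<le> ennreal C * m"
  shows "ennreal (inverse C * a) \<le> m"
proof -
  have "ennreal (inverse C * a) = ennreal (inverse C) * ennreal a"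
    using assms by (simp add: ennreal_mult)
  also have "\<dots> \<le> ennreal (inverse C) * (ennreal C * m)"
    using assms by (intro mult_left_mono) auto
  also have "\<dots> = ennreal (inverse C * C) * m"
    using assms by (subst ennreal_mult) (auto simp: mult.assoc)
  also have "\<dots> = m" using assms by simp
  finally show ?thesis .
qed

theorem theorem1p2:
  fixes \<pi> :: "'x::metric_space \<Rightarrow> 'y::topological_space"
    and \<mu> :: "'y measure"
    and L M Q :: real
    and \<phi> :: "'y \<Rightarrow> 'x"
  assumes "open_quotient_map \<pi>"
    and "space \<mu> = UNIV"
    and "\<forall>r0>0. \<forall>x x'. \<pi> x = \<pi> x' \<longrightarrow>
           (\<exists>C>0. \<forall>r>r0. outer_measure_of \<mu> (\<pi> ` ball x r)
                          \<le> ennreal C * outer_measure_of \<mu> (\<pi> ` ball x' r))"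
    and "L \<ge> 1" and "M \<ge> 0" and "Q > 0"
    and "quasi_isometric_section L M \<pi> \<phi>"
    and "large_scale_AD_regular Q (push_forward \<phi> \<mu>) (range \<phi>)"
  shows "\<forall>\<psi>. quasi_isometric_section L M \<pi> \<psi> \<longrightarrow>
           (\<forall>y. \<exists>r0>0. \<exists>c3>0. \<exists>c4>0. \<forall>r>r0.
              ennreal (c3 * (r - M) powr Q)
                \<le> push_forward \<psi> \<mu> (ball (\<psi> y) r \<inter> range \<psi>) \<and>
              push_forward \<psi> \<mu> (ball (\<psi> y) r \<inter> range \<psi>)
                \<le> ennreal (c4 * (r + M) powr Q))"
proof (intro allI impI)
  fix \<psi> :: "'y \<Rightarrow> 'x" and y
  assume \<psi>: "quasi_isometric_section L M \<pi> \<psi>"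
  note \<phi> = assms(7)
  have L0: "L > 0" using \<open>L \<ge> 1\<close> by simp
  obtain \<rho> A where "\<rho> > 0" "A > 0"
    and lower: "\<And>r. r > \<rho> \<Longrightarrow> ennreal (inverse A * r powr Q) \<le> push_forward \<phi> \<mu> (ball (\<phi> y) r)"
    and upper: "\<And>r. r > \<rho> \<Longrightarrow> push_forward \<phi> \<mu> (ball (\<phi> y) r) \<le> ennreal (A * r powr Q)"
    using assms(8) unfolding large_scale_AD_regular_def push_forward_Int_range by blast
  have fibre: "\<pi> (\<phi> y) = \<pi> (\<psi> y)" using \<phi> \<psi> by simp
  obtain C where "C > 0" and C: "\<And>r. r > \<rho> \<Longrightarrow> outer_measure_of \<mu> (\<pi> ` ball (\<psi> y) r)
      \<le> ennreal C * outer_measure_of \<mu> (\<pi> ` ball (\<phi> y) r)"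
    using assms(3) \<open>\<rho> > 0\<close> fibre by metis
  obtain D where "D > 0" and D: "\<And>r. r > \<rho> \<Longrightarrow> outer_measure_of \<mu> (\<pi> ` ball (\<phi> y) r)
      \<le> ennreal D * outer_measure_of \<mu> (\<pi> ` ball (\<psi> y) r)"
    using assms(3) \<open>\<rho> > 0\<close> fibre by metis
  define r0 where "r0 = L * \<rho> + M"
  define c3 where "c3 = inverse D * (inverse A * inverse (L powr Q))"
  define c4 where "c4 = C * (A * L powr Q)"
  have "r0 > 0" "c3 > 0" "c4 > 0"
    using L0 \<open>\<rho> > 0\<close> \<open>A > 0\<close> \<open>C > 0\<close> \<open>D > 0\<close> \<open>M \<ge> 0\<close>
    by (auto simp: r0_def c3_def c4_def add_pos_nonneg)
  have low: "ennreal (c3 * (r - M) powr Q) \<le> push_forward \<psi> \<mu> (ball (\<psi> y) r)"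
    if "r > r0" for r
  proof -
    \<comment> \<open>The radius that \<open>r \<mapsto> L * r + M\<close> sends to the given one.\<close>
    define s where "s = (r - M) / L"
    have "s > \<rho>" and Ls: "L * s + M = r"
      using that L0 by (auto simp: s_def r0_def field_simps)
    have "ennreal (inverse A * s powr Q) \<le> push_forward \<phi> \<mu> (ball (\<phi> y) s)"
      by (rule lower[OF \<open>s > \<rho>\<close>])
    also have "\<dots> \<le> ennreal D * push_forward \<psi> \<mu> (ball (\<psi> y) r)"
      using section_preimage_ball_comparison[OF \<phi> \<psi> L0 D[OF \<open>s > \<rho>\<close>]] Ls by simp
    finally have *: "ennreal (inverse A * s powr Q) \<le> ennreal D * push_forward \<psi> \<mu> (ball (\<psi> y) r)" .
    have "ennreal (inverse D * (inverse A * s powr Q)) \<le> push_forward \<psi> \<mu> (ball (\<psi> y) r)"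
      using \<open>A > 0\<close> \<open>D > 0\<close> by (intro ennreal_inverse_mult_le[OF _ _ *]) simp_all
    moreover have "s powr Q = inverse (L powr Q) * (r - M) powr Q"
      using \<open>s > \<rho>\<close> \<open>\<rho> > 0\<close> L0 unfolding s_def
      by (subst powr_divide) (simp_all add: zero_less_divide_iff divide_inverse mult.commute)
    ultimately show ?thesis by (simp add: c3_def mult.assoc)
  qed
  have up: "push_forward \<psi> \<mu> (ball (\<psi> y) r) \<le> ennreal (c4 * (r + M) powr Q)"
    if "r > r0" for r
  proof -
    have "\<rho> \<le> L * \<rho>" using \<open>L \<ge> 1\<close> \<open>\<rho> > 0\<close> by simp
    then have "r > \<rho>" using that \<open>M \<ge> 0\<close> by (simp add: r0_def)
    then have "r > 0" using \<open>\<rho> > 0\<close> by simp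
    have "r \<le> L * r" "M \<le> L * M"
      using \<open>L \<ge> 1\<close> \<open>r > 0\<close> \<open>M \<ge> 0\<close> by (simp_all add: mult_le_cancel_right1)
    then have big: "L * r + M > \<rho>" and le: "L * r + M \<le> L * (r + M)"
      using \<open>r > \<rho>\<close> \<open>M \<ge> 0\<close> by (simp_all add: distrib_left)
    have "push_forward \<psi> \<mu> (ball (\<psi> y) r) \<le> ennreal C * push_forward \<phi> \<mu> (ball (\<phi> y) (L * r + M))"
      by (rule section_preimage_ball_comparison[OF \<psi> \<phi> L0 C[OF \<open>r > \<rho>\<close>]])
    also have "\<dots> \<le> ennreal C * ennreal (A * (L * r + M) powr Q)"
      by (intro mult_left_mono upper big) simp
    also have "\<dots> = ennreal (C * (A * (L * r + M) powr Q))"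
      using \<open>A > 0\<close> \<open>C > 0\<close> by (simp add: ennreal_mult)
    also have "\<dots> \<le> ennreal (C * (A * (L * (r + M)) powr Q))"
      using \<open>A > 0\<close> \<open>C > 0\<close> \<open>Q > 0\<close> big \<open>\<rho> > 0\<close> le
      by (intro ennreal_leI mult_left_mono powr_mono2) auto
    also have "\<dots> = ennreal (c4 * (r + M) powr Q)"
      using L0 \<open>r > 0\<close> \<open>M \<ge> 0\<close> by (simp add: powr_mult c4_def mult.assoc)
    finally show ?thesis .
  qed
  show "\<exists>r0>0. \<exists>c3>0. \<exists>c4>0. \<forall>r>r0.
          ennreal (c3 * (r - M) powr Q) \<le> push_forward \<psi> \<mu> (ball (\<psi> y) r \<inter> range \<psi>) \<and>
          push_forward \<psi> \<mu> (ball (\<psi> y) r \<inter> range \<psi>) \<le> ennreal (c4 * (r + M) powr Q)"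
    unfolding push_forward_Int_range
    by (intro exI conjI allI impI) (rule \<open>r0 > 0\<close> \<open>c3 > 0\<close> \<open>c4 > 0\<close> low up, assumption?)+
qed

end
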